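(* Consider the problem of minimizing $f(x)=\sum_{i=1}^m f_i(x)$ over $x\in\mathbb{R}^d$, with $f_i:\mathbb{R}^d\to\mathbb{R}$. Assume that: (i) each $f_i$ is convex and has $L$-Lipschitz continuous gradient, i.e. $f_i(x)+\langle\nabla f_i(x),y-x\rangle\le f_i(y)\le f_i(x)+\langle\nabla f_i(x),y-x\rangle+\frac L2\|y-x\|^2$ for all $x,y\in\mathbb{R}^d$; (ii) each $f_i$ can be written as $f_i(x)=\ell(a_i^Tx,b_i)$ such that $\mathrm{supp}(\nabla f_i(x))=\mathrm{supp}(a_i)$, for given data $\{(a_i,b_i)\}_{i=1}^m$ with $a_i\in\mathbb{R}^d$, $b_i\in\mathbb{R}$; (iii) $f$ is $\mu$-strongly convex with $\mu>0$, i.e. $f(y)\ge f(x)+\langle\nabla f(x),y-x\rangle+\frac\mu2\|y-x\|^2$ for all $x,y\in\mathbb{R}^d$. Let $\bar L=L\sqrt{m(1+\Delta)}$ and $\Delta=\min(\Delta_{\rm ave},\Delta_{\max})$. Let $Q$ be an unbiased random quantizer with parameter $\alpha$. Given $\varepsilon_0=\|x_0-x^\star\|^2$, by running $$x_{k+1}=x_k-\gamma_kQ(\nabla f(x_k))\qquad\text{with}\qquad \gamma_k=\frac1\alpha\cdot\frac{2}{\mu+\bar L}$$ for at most $$k^\star=\alpha\frac{(\mu+\bar L)^2}{4\mu\bar L}\log(\varepsilon_0/\varepsilon)$$ iterations, under which $$B^\star=(\log_2d+B)\,c\cdot\alpha\frac{(\mu+\bar L)^2}{4\mu\bar L}\log(\varepsilon_0/\varepsilon)$$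 bits are sent, we ensure that $\mathbf{E}\|x_k-x^\star\|^2\le\varepsilon$. Here $B$ is the number of bits required to encode a single vector entry and $\mathbf{E}\{\|Q(v)\|_0\}\le c$.
   Context: $\|\cdot\|$ is the Euclidean norm, $\|v\|_0$ is the number of nonzero entries of $v$, and $\mathrm{supp}(x)=\{i: x^i\ne0\}$, where $x^i$ is the $i$-th entry of $x$. $x^\star$ is the minimizer of $f$, $x_0\in\mathbb{R}^d$ is the initial point, $\varepsilon>0$ is the target accuracy, and $\log$ is the natural logarithm. Conflict graph degrees of the data: $\Delta_{\rm ave}=\frac1m\sum_{i=1}^m\sum_{j\ne i}\mathbf 1\{\mathrm{supp}(a_i)\cap\mathrm{supp}(a_j)\ne\emptyset\}$ and $\Delta_{\max}=\max_{i}\sum_{j\ne i}\mathbf 1\{\mathrm{supp}(a_i)\cap\mathrm{supp}(a_j)\ne\emptyset\}$. An unbiased random quantizer with parameter $\alpha$ (finite, positive) is a random mapping $Q:\mathbb{R}^d\to\mathbb{R}^d$ such that for every $v\in\mathbb{R}^d$: $\mathrm{supp}(Q(v))\subseteq\mathrm{supp}(v)$, $\mathbf{E}\{Q(v)\}=v$, and $\mathbf{E}\{\|Q(v)\|^2\}\le\alpha\|v\|^2$. The constant $c\le d$ is finite and positive, with $\mathbf{E}\{\|Q(v)\|_0\}\le c$ for any $v\in\mathbb{R}^d$. Each application of $Q$ uses fresh randomness. Bit count: a naive encoding of a vector processed by the quantizer is taken to require $c(\log_2d+B)$ bits, namely $\log_2d$ bits to represent each index and $B$ bits to represent the corresponding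 vector entry of $c$ nonzero values; one quantized vector is sent per iteration. *)

theory Defs
  imports "HOL-Probability.Probability"
begin

definition supp :: "real ^ 'd \<Rightarrow> 'd set" where
  "supp v = {i. v $ i \<noteq> 0}"

definition nnz :: "real ^ 'd \<Rightarrow> nat" where
  "nnz v = card (supp v)"

definition gradient :: "('a::real_inner \<Rightarrow> real) \<Rightarrow> 'a \<Rightarrow> 'a" where
  "gradient f x = (THE D. GDERIV f x :> D)"

lemma gradient_eqI:
  fixes f :: "'a::real_inner \<Rightarrow> real"
  assumes "GDERIV f x :> D"
  shows "gradient f x = D"
  unfolding gradient_def
proof (rule the_equality)
  show "GDERIV f x :> D" by fact
next
  fix D' assume "GDERIV f x :> D'"
  then have "(\<lambda>h. h \<bullet> D') = (\<lambda>h. h \<bullet> D)"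
    using assms unfolding gderiv_def by (rule has_derivative_unique)
  then have "h \<bullet> D' = h \<bullet> D" for h
    by (rule fun_cong)
  then show "D' = D"
    by (metis vector_eq_rdot inner_commute)
qed

lemma GDERIV_gradient:
  fixes f :: "'a::euclidean_space \<Rightarrow> real"
  assumes "f differentiable (at x)"
  shows "GDERIV f x :> gradient f x"
proof -
  obtain f' where f': "(f has_derivative f') (at x)"
    using assms unfolding differentiable_def by blast
  then have "linear f'" by (rule has_derivative_linear)
  then have "f' = (\<lambda>h. h \<bullet> adjoint f' 1)"
    by (auto simp: fun_eq_iff adjoint_works)
  with f' have "GDERIV f x :> adjoint f' 1"
    unfolding gderiv_def by metis
  then show ?thesis using gradient_eqI by metis
qed

definition convex_smooth :: "real \<Rightarrow> ('a::real_inner \<Rightarrow> real) \<Rightarrow> bool" where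
  "convex_smooth L f \<longleftrightarrow>
     (\<forall>x. f differentiable (at x)) \<and>
     (\<forall>x y. f x + gradient f x \<bullet> (y - x) \<le> f y \<and>
            f y \<le> f x + gradient f x \<bullet> (y - x) + L / 2 * (norm (y - x))\<^sup>2)"

definition strongly_convex :: "real \<Rightarrow> ('a::real_inner \<Rightarrow> real) \<Rightarrow> bool" where
  "strongly_convex \<mu> f \<longleftrightarrow>
     (\<forall>x. f differentiable (at x)) \<and>
     (\<forall>x y. f x + gradient f x \<bullet> (y - x) + \<mu> / 2 * (norm (y - x))\<^sup>2 \<le> f y)"

definition conflict_degree :: "nat \<Rightarrow> (nat \<Rightarrow> real ^ 'd) \<Rightarrow> nat \<Rightarrow> real" where
  "conflict_degree m a i =
     (\<Sum>j\<in>{1..m} - {i}. of_bool (supp (a i) \<inter> supp (a j) \<noteq> {}))"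

definition Delta_ave :: "nat \<Rightarrow> (nat \<Rightarrow> real ^ 'd) \<Rightarrow> real" where
  "Delta_ave m a = 1 / real m * (\<Sum>i=1..m. conflict_degree m a i)"

definition Delta_max :: "nat \<Rightarrow> (nat \<Rightarrow> real ^ 'd) \<Rightarrow> real" where
  "Delta_max m a = Max (conflict_degree m a ` {1..m})"

(* Randomness is carried by a seed drawn from the probability space N; Q s v is the
   outcome of quantizing v with seed s. Integrability is stated explicitly because the
   Bochner integral of a non-integrable function is 0 by convention. *)
definition unbiased_quantizer ::
    "'s measure \<Rightarrow> ('s \<Rightarrow> real ^ 'd \<Rightarrow> real ^ 'd) \<Rightarrow> real \<Rightarrow> bool" where
  "unbiased_quantizer N Q \<alpha> \<longleftrightarrow>
     prob_space N \<and> 0 < \<alpha> \<and>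
     case_prod Q \<in> borel_measurable (N \<Otimes>\<^sub>M borel) \<and>
     (\<forall>v. (AE s in N. supp (Q s v) \<subseteq> supp v) \<and>
          integrable N (\<lambda>s. Q s v) \<and> (\<integral>s. Q s v \<partial>N) = v \<and>
          integrable N (\<lambda>s. (norm (Q s v))\<^sup>2) \<and>
          (\<integral>s. (norm (Q s v))\<^sup>2 \<partial>N) \<le> \<alpha> * (norm v)\<^sup>2)"

(* Bits needed to send v itself: an index and a value for every nonzero entry. *)
definition encoding_bits :: "real \<Rightarrow> real ^ 'd \<Rightarrow> real" where
  "encoding_bits B v = real (nnz v) * (log 2 (real CARD('d)) + B)"

(* Nominal cost of n iterations, one message with c nonzero entries each. The iteration
   count n is real since the bound on it in the theorem need not be an integer. *)
definition naive_bits :: "nat \<Rightarrow> real \<Rightarrow> real \<Rightarrow> real \<Rightarrow> real" where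
  "naive_bits d c B n = n * (c * (log 2 (real d) + B))"

end

theory Submission
  imports Defs
begin

text \<open>
  Three facts give the convergence rate.

  The gradient of \<open>f\<close> is Lipschitz with constant \<open>Lbar\<close>, which is smaller than the obvious
  \<open>m * L\<close> when the data overlap rarely. For two points, the gradient difference of each summand
  has norm at most \<open>L\<close> times their distance and lives on the support of \<open>a i\<close>. Expanding the
  square of the sum of these differences leaves only the inner products of conflicting pairs,
  of which there are \<open>m * (1 + Delta_ave m a)\<close>, each index conflicting with itself
  (\<open>norm_sum_le_conflict\<close>, \<open>lipschitz_gradient_sum\<close>). An average is at most a maximum, so the
  minimum that defines \<open>\<Delta>\<close> is always the average degree.

  A \<open>\<mu>\<close>-strongly convex function with such a gradient satisfies the inequality
  \<open>strongly_convex_gradient_inequality\<close>, which bounds the inner product of gradient and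
  displacement below by a combination of both squared norms. In the second moment of one
  quantized step, unbiasedness turns the cross term into this inner product, the variance bound
  costs \<open>\<gamma>\<^sup>2 * \<alpha>\<close> times the squared gradient norm, and the step size is the one for which that
  cost is paid exactly. What remains is a contraction by \<open>1 - q\<close> with
  \<open>q = 4 * \<mu> * Lbar / (\<alpha> * (\<mu> + Lbar)\<^sup>2)\<close>, hence by \<open>exp (- q)\<close> (\<open>quantized_step_contraction\<close>).

  The seed of a step is independent of the iterate to which it is applied, because that iterate
  is a function of the earlier seeds only. Fubini's theorem (\<open>nn_integral_fresh_seed_le\<close>) thus
  transfers bounds that hold for every fixed argument of the quantizer to the random iterates.
  For the squared distance to the minimizer this gives \<open>exp (- q * k) * \<epsilon>0\<close> after \<open>k\<close> steps,
  which is at most \<open>\<epsilon>\<close> as soon as \<open>k\<close> reaches \<open>ln (\<epsilon>0 / \<epsilon>) / q\<close>; for the number of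
  nonzero entries it gives the bound \<open>c\<close> on every message, and the bit count follows by linearity.
\<close>

section \<open>Functions between a linear and a quadratic bound\<close>

text \<open>
  After subtracting its tangent at \<open>x\<close> the function has its minimum at \<open>x\<close>, and a gradient step
  of length \<open>t\<close> from \<open>y\<close> cannot go below that minimum. The upper bound says how much such a step
  gains, so the gap at \<open>y\<close> controls the gradient difference; adding the two versions with \<open>x\<close> and
  \<open>y\<close> exchanged cancels the function values. The statement constrains \<open>g\<close> by
  the two bounds alone, because these pass to a function shifted by a multiple of the squared norm.
\<close>

lemma gradient_cocoercive:
  fixes f :: "'a::real_inner \<Rightarrow> real" and g :: "'a \<Rightarrow> 'a"
  assumes lower: "\<And>x y. f x + g x \<bullet> (y - x) \<le> f y"
    and upper: "\<And>x y. f y \<le> f x + g x \<bullet> (y - x) + L / 2 * (norm (y - x))\<^sup>2"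
    and "0 \<le> L"
  shows "(norm (g x - g y))\<^sup>2 \<le> L * ((g x - g y) \<bullet> (x - y))"
proof -
  have half: "t * (1 - L * t / 2) * (norm (g y - g x))\<^sup>2 \<le> f y - f x - g x \<bullet> (y - x)" for x y t
  proof -
    define d where "d = g y - g x"
    define w where "w = y - t *\<^sub>R d"
    have wy: "w - y = - (t *\<^sub>R d)" and wx: "w - x = (y - x) - t *\<^sub>R d"
      by (simp_all add: w_def)
    have "f x + g x \<bullet> (w - x) \<le> f y + g y \<bullet> (w - y) + L / 2 * (norm (w - y))\<^sup>2"
      using lower[of x w] upper[of w y] by linarith
    moreover have "g x \<bullet> (w - x) = g x \<bullet> (y - x) - t * (g x \<bullet> d)"
      by (simp add: wx inner_diff_right)
    moreover have "g y \<bullet> (w - y) = - (t * (g y \<bullet> d))"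
      by (simp add: wy)
    moreover have "(norm (w - y))\<^sup>2 = t\<^sup>2 * (norm d)\<^sup>2"
      by (simp add: wy power_mult_distrib)
    moreover have "t * (norm d)\<^sup>2 = t * (g y \<bullet> d) - t * (g x \<bullet> d)"
      by (simp add: d_def power2_norm_eq_inner inner_diff_left right_diff_distrib)
    moreover have "t * (1 - L * t / 2) * (norm d)\<^sup>2 = t * (norm d)\<^sup>2 - L / 2 * (t\<^sup>2 * (norm d)\<^sup>2)"
      by (simp add: algebra_simps power2_eq_square)
    ultimately show ?thesis
      unfolding d_def[symmetric] by simp
  qed
  define D where "D = (norm (g x - g y))\<^sup>2"
  define p where "p = (g x - g y) \<bullet> (x - y)"
  have key: "t * (2 - L * t) * D \<le> p" for t
    using half[of t x y] half[of t y x]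
    by (simp add: D_def p_def norm_minus_commute inner_diff_left inner_diff_right algebra_simps)
  have "D \<le> L * p"
    \<comment> \<open>For \<open>L > 0\<close> the best step length is \<open>1 / L\<close>. For \<open>L = 0\<close> arbitrarily long steps are
      allowed, which forces the gradients to agree.\<close>
  proof (cases "L = 0")
    case True
    have "D = 0"
    proof (rule ccontr)
      assume "D \<noteq> 0"
      then show False
        using key[of "(\<bar>p\<bar> + 1) / D"] True by simp
    qed
    then show ?thesis using True by simp
  next
    case False
    then show ?thesis
      using key[of "1 / L"] \<open>0 \<le> L\<close> by (simp add: field_simps)
  qed
  then show ?thesis by (simp add: D_def p_def)
qed

text \<open>
  Along the segment from \<open>x\<close> to \<open>y\<close>, the difference of the two sides has a derivative whose sign is
  decided by the Lipschitz bound and the Cauchy-Schwarz inequality.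
\<close>

lemma quadratic_upper_bound_of_lipschitz_gradient:
  fixes f :: "'a::real_inner \<Rightarrow> real"
  assumes deriv: "\<And>z. GDERIV f z :> g z"
    and lip: "\<And>x y. norm (g x - g y) \<le> K * norm (x - y)"
  shows "f y \<le> f x + g x \<bullet> (y - x) + K / 2 * (norm (y - x))\<^sup>2"
proof -
  define d where "d = y - x"
  define h where "h t = f (x + t *\<^sub>R d) - t * (g x \<bullet> d) - K * t\<^sup>2 / 2 * (norm d)\<^sup>2" for t :: real
  have dh: "(h has_real_derivative (g (x + t *\<^sub>R d) \<bullet> d - g x \<bullet> d - K * t * (norm d)\<^sup>2)) (at t)" for t
  proof -
    have "((\<lambda>t. x + t *\<^sub>R d) has_derivative (\<lambda>s. s *\<^sub>R d)) (at t)"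
      by (auto intro!: derivative_eq_intros)
    moreover have "(f has_derivative (\<lambda>h. h \<bullet> g (x + t *\<^sub>R d))) (at (x + t *\<^sub>R d))"
      using deriv unfolding gderiv_def .
    ultimately have "((\<lambda>t. f (x + t *\<^sub>R d)) has_derivative (\<lambda>s. (s *\<^sub>R d) \<bullet> g (x + t *\<^sub>R d))) (at t)"
      by (rule has_derivative_compose)
    then have "((\<lambda>t. f (x + t *\<^sub>R d)) has_real_derivative (g (x + t *\<^sub>R d) \<bullet> d)) (at t)"
      by (rule has_derivative_imp_has_field_derivative) (simp add: inner_commute)
    then show ?thesis
      unfolding h_def by (auto intro!: derivative_eq_intros)
  qed
  have "h 1 \<le> h 0"
  proof (rule DERIV_nonpos_imp_nonincreasing[where f = h and a = 0 and b = 1])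
    fix t :: real assume t: "0 \<le> t" "t \<le> 1"
    have "(g (x + t *\<^sub>R d) - g x) \<bullet> d \<le> norm (g (x + t *\<^sub>R d) - g x) * norm d"
      by (rule norm_cauchy_schwarz)
    also have "\<dots> \<le> (K * norm (t *\<^sub>R d)) * norm d"
      using lip[of "x + t *\<^sub>R d" x] by (intro mult_right_mono) auto
    also have "\<dots> = K * t * (norm d)\<^sup>2"
      using t by (simp add: power2_eq_square)
    finally have "g (x + t *\<^sub>R d) \<bullet> d - g x \<bullet> d - K * t * (norm d)\<^sup>2 \<le> 0"
      by (simp add: inner_diff_left)
    then show "\<exists>y. DERIV h t :> y \<and> y \<le> 0"
      using dh by blast
  qed simp
  then show ?thesis by (simp add: h_def d_def)
qed

text \<open>
  Subtracting \<open>\<mu> / 2\<close> times the squared norm from \<open>f\<close> leaves a convex function with quadratic upper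
  constant \<open>K - \<mu>\<close>, and the claim is the expanded form of its cocoercivity. The case \<open>K = \<mu>\<close> is
  why cocoercivity is needed for the constant zero, too.
\<close>

lemma strongly_convex_gradient_inequality:
  fixes f :: "'a::real_inner \<Rightarrow> real" and g :: "'a \<Rightarrow> 'a"
  assumes lower: "\<And>x y. f x + g x \<bullet> (y - x) + \<mu> / 2 * (norm (y - x))\<^sup>2 \<le> f y"
    and upper: "\<And>x y. f y \<le> f x + g x \<bullet> (y - x) + K / 2 * (norm (y - x))\<^sup>2"
    and "\<mu> \<le> K"
  shows "(norm (g x - g y))\<^sup>2 + \<mu> * K * (norm (x - y))\<^sup>2 \<le> (\<mu> + K) * ((g x - g y) \<bullet> (x - y))"
proof -
  define \<psi> where "\<psi> z = f z - \<mu> / 2 * (norm z)\<^sup>2" for z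
  define h where "h z = g z - \<mu> *\<^sub>R z" for z
  have shift: "\<psi> u + h u \<bullet> (v - u) = f u + g u \<bullet> (v - u) + \<mu> / 2 * (norm (v - u))\<^sup>2 - \<mu> / 2 * (norm v)\<^sup>2" for u v
    unfolding \<psi>_def h_def power2_norm_eq_inner
    by (simp add: inner_diff_left inner_diff_right inner_commute field_simps)
  have "(norm (h x - h y))\<^sup>2 \<le> (K - \<mu>) * ((h x - h y) \<bullet> (x - y))"
  proof (rule gradient_cocoercive[where f = \<psi>])
    show "\<psi> u + h u \<bullet> (v - u) \<le> \<psi> v" for u v
      using lower[of u v] unfolding shift by (simp add: \<psi>_def)
    show "\<psi> v \<le> \<psi> u + h u \<bullet> (v - u) + (K - \<mu>) / 2 * (norm (v - u))\<^sup>2" for u v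
      using upper[of v u] unfolding shift by (simp add: \<psi>_def field_simps)
  qed (use \<open>\<mu> \<le> K\<close> in simp)
  moreover define G where "G = g x - g y"
  moreover define D where "D = x - y"
  moreover have "h x - h y = G - \<mu> *\<^sub>R D"
    by (simp add: h_def G_def D_def algebra_simps)
  ultimately have "(norm (G - \<mu> *\<^sub>R D))\<^sup>2 \<le> (K - \<mu>) * ((G - \<mu> *\<^sub>R D) \<bullet> D)"
    by simp
  then show ?thesis
    unfolding G_def[symmetric] D_def[symmetric] power2_norm_eq_inner
    by (simp add: inner_diff_left inner_diff_right inner_commute algebra_simps)
qed

lemma quadratic_bounds_le:
  fixes f :: "'a::euclidean_space \<Rightarrow> real" and g :: "'a \<Rightarrow> 'a"
  assumes lower: "\<And>x y. f x + g x \<bullet> (y - x) + \<mu> / 2 * (norm (y - x))\<^sup>2 \<le> f y"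
    and upper: "\<And>x y. f y \<le> f x + g x \<bullet> (y - x) + K / 2 * (norm (y - x))\<^sup>2"
  shows "\<mu> \<le> K"
proof -
  obtain u :: 'a where "norm u = 1"
    using vector_choose_size[of 1] by auto
  then show ?thesis
    using lower[of 0 u] upper[of u 0] by simp
qed

section \<open>Smoothness of a sum with sparsely overlapping terms\<close>

lemma inner_eq_0_if_disjoint_supp:
  fixes u v :: "real ^ 'd"
  assumes "supp u \<inter> supp v = {}"
  shows "u \<bullet> v = 0"
  using assms by (auto simp: inner_vec_def supp_def intro!: sum.neutral)

lemma Delta_ave_le_Delta_max:
  assumes "0 < m"
  shows "Delta_ave m a \<le> Delta_max m a"
proof -
  have "(\<Sum>i=1..m. conflict_degree m a i) \<le> (\<Sum>i=1..m. Delta_max m a)"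
    unfolding Delta_max_def by (intro sum_mono Max_ge) auto
  then show ?thesis
    using assms by (simp add: Delta_ave_def field_simps)
qed

text \<open>
  In the double sum of inner products, a pair with disjoint supports contributes nothing and any
  other pair at most \<open>r\<^sup>2\<close>. Row \<open>i\<close> has \<open>conflict_degree m a i\<close> conflicting pairs off the diagonal
  and one on it, and averaging over the rows produces \<open>1 + Delta_ave m a\<close>.
\<close>

lemma norm_sum_le_conflict:
  fixes g :: "nat \<Rightarrow> real ^ 'd"
  assumes sub: "\<And>i. i \<in> {1..m} \<Longrightarrow> supp (g i) \<subseteq> supp (a i)"
    and bound: "\<And>i. i \<in> {1..m} \<Longrightarrow> norm (g i) \<le> r"
    and "0 < m" and "0 \<le> r"
  shows "(norm (\<Sum>i=1..m. g i))\<^sup>2 \<le> real m * (1 + Delta_ave m a) * r\<^sup>2"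
proof -
  have pair: "g i \<bullet> g j \<le> of_bool (supp (a i) \<inter> supp (a j) \<noteq> {}) * r\<^sup>2"
    if "i \<in> {1..m}" "j \<in> {1..m}" for i j
  proof (cases "supp (a i) \<inter> supp (a j) = {}")
    case True
    then have "g i \<bullet> g j = 0"
      using sub that by (intro inner_eq_0_if_disjoint_supp) blast
    then show ?thesis by simp
  next
    case False
    have "g i \<bullet> g j \<le> norm (g i) * norm (g j)"
      by (rule norm_cauchy_schwarz)
    also have "\<dots> \<le> r * r"
      using that bound \<open>0 \<le> r\<close> by (intro mult_mono) auto
    finally show ?thesis using False by (simp add: power2_eq_square)
  qed
  have row: "(\<Sum>j=1..m. g i \<bullet> g j) \<le> (1 + conflict_degree m a i) * r\<^sup>2" if i: "i \<in> {1..m}" for i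
  proof -
    have "g i \<bullet> g i \<le> r\<^sup>2"
      using bound[OF i] by (simp add: power2_norm_eq_inner[symmetric] power_mono)
    moreover have "(\<Sum>j\<in>{1..m} - {i}. g i \<bullet> g j) \<le> conflict_degree m a i * r\<^sup>2"
      unfolding conflict_degree_def sum_distrib_right using i by (intro sum_mono pair) auto
    ultimately show ?thesis
      using i by (subst sum.remove[of _ i]) (auto simp: algebra_simps)
  qed
  have "(norm (\<Sum>i=1..m. g i))\<^sup>2 = (\<Sum>i=1..m. \<Sum>j=1..m. g i \<bullet> g j)"
    unfolding power2_norm_eq_inner inner_sum_left by (simp add: inner_sum_right)
  also have "\<dots> \<le> (\<Sum>i=1..m. (1 + conflict_degree m a i) * r\<^sup>2)"
    by (intro sum_mono row)
  also have "\<dots> = real m * (1 + Delta_ave m a) * r\<^sup>2"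
    using \<open>0 < m\<close> by (simp add: Delta_ave_def sum_distrib_right[symmetric] sum.distrib field_simps)
  finally show ?thesis .
qed

lemma convex_smooth_imp_lipschitz_gradient:
  assumes "convex_smooth L f" "0 < L"
  shows "norm (gradient f x - gradient f y) \<le> L * norm (x - y)"
proof -
  let ?G = "gradient f x - gradient f y"
  have "(norm ?G)\<^sup>2 \<le> L * (?G \<bullet> (x - y))"
    using assms by (intro gradient_cocoercive[where f = f]) (auto simp: convex_smooth_def)
  also have "\<dots> \<le> L * (norm ?G * norm (x - y))"
    using assms by (intro mult_left_mono norm_cauchy_schwarz) auto
  finally have "norm ?G * norm ?G \<le> norm ?G * (L * norm (x - y))"
    by (simp add: power2_eq_square algebra_simps)
  then show ?thesis
    using assms by (cases "norm ?G = 0") (auto simp: mult_le_cancel_left)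
qed

lemma lipschitz_gradient_sum:
  fixes F :: "nat \<Rightarrow> real ^ 'd \<Rightarrow> real"
  assumes smooth: "\<And>i. i \<in> {1..m} \<Longrightarrow> convex_smooth L (F i)"
    and supp: "\<And>i z. i \<in> {1..m} \<Longrightarrow> supp (gradient (F i) z) \<subseteq> supp (a i)"
    and "0 < m" and "0 < L"
  shows "norm ((\<Sum>i=1..m. gradient (F i) x) - (\<Sum>i=1..m. gradient (F i) y))
           \<le> L * sqrt (real m * (1 + Delta_ave m a)) * norm (x - y)"
proof -
  define g where "g i = gradient (F i) x - gradient (F i) y" for i
  have "(norm (\<Sum>i=1..m. g i))\<^sup>2 \<le> real m * (1 + Delta_ave m a) * (L * norm (x - y))\<^sup>2"
  proof (rule norm_sum_le_conflict)
    show "supp (g i) \<subseteq> supp (a i)" if "i \<in> {1..m}" for i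
      using supp[OF that, of x] supp[OF that, of y] by (fastforce simp: supp_def g_def)
    show "norm (g i) \<le> L * norm (x - y)" if "i \<in> {1..m}" for i
      unfolding g_def using smooth[OF that] \<open>0 < L\<close> by (rule convex_smooth_imp_lipschitz_gradient)
  qed (use assms in auto)
  then have "norm (\<Sum>i=1..m. g i) \<le> sqrt (real m * (1 + Delta_ave m a) * (L * norm (x - y))\<^sup>2)"
    by (rule real_le_rsqrt)
  also have "\<dots> = L * sqrt (real m * (1 + Delta_ave m a)) * norm (x - y)"
    using \<open>0 < L\<close> by (simp only: real_sqrt_mult real_sqrt_abs) simp
  finally show ?thesis
    by (simp add: g_def sum_subtractf)
qed

lemma GDERIV_sum:
  assumes "\<And>i. i \<in> I \<Longrightarrow> GDERIV (F i) x :> G i"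
  shows "GDERIV (\<lambda>z. \<Sum>i\<in>I. F i z) x :> (\<Sum>i\<in>I. G i)"
  using assms unfolding gderiv_def inner_sum_right by (rule has_derivative_sum)

section \<open>Expectations over a fresh seed\<close>

text \<open>
  Any function \<open>\<phi>\<close> of the first \<open>k\<close> seeds is independent of seed \<open>k\<close>. The proof starts from the
  product law of the blocks of seeds indexed by \<open>{..<k}\<close> and \<open>{k}\<close>, and pushes it forward along \<open>\<phi>\<close>
  and the evaluation at \<open>k\<close>.
\<close>

lemma distr_past_and_fresh_seed:
  fixes \<xi> :: "nat \<Rightarrow> 'w \<Rightarrow> 's"
  assumes M: "prob_space M" and indep: "prob_space.indep_vars M (\<lambda>_. N) \<xi> UNIV"
    and distr: "distr M N (\<xi> k) = N"
    and \<phi>[measurable]: "\<phi> \<in> measurable (PiM {..<k} (\<lambda>_. N)) S"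
  shows "distr M (S \<Otimes>\<^sub>M N) (\<lambda>\<omega>. (\<phi> (restrict (\<lambda>i. \<xi> i \<omega>) {..<k}), \<xi> k \<omega>))
    = distr M S (\<lambda>\<omega>. \<phi> (restrict (\<lambda>i. \<xi> i \<omega>) {..<k})) \<Otimes>\<^sub>M N"
proof -
  interpret prob_space M by fact
  have [measurable]: "\<xi> i \<in> measurable M N" for i
    using indep by (simp add: indep_vars_def)
  let ?A = "PiM {..<k} (\<lambda>_. N)" and ?B = "PiM {k} (\<lambda>_. N)"
  let ?X = "\<lambda>\<omega>. restrict (\<lambda>i. \<xi> i \<omega>) {..<k}" and ?Y = "\<lambda>\<omega>. restrict (\<lambda>i. \<xi> i \<omega>) {k}"
  have X[measurable]: "?X \<in> measurable M ?A" and Y[measurable]: "?Y \<in> measurable M ?B"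
    by (auto intro!: measurable_restrict)
  have k[measurable]: "(\<lambda>s. s k) \<in> measurable ?B N"
    by (rule measurable_component_singleton) simp
  have "indep_var ?A ?X ?B ?Y"
    using indep by (intro indep_var_restrict) auto
  then have joint: "distr M ?A ?X \<Otimes>\<^sub>M distr M ?B ?Y = distr M (?A \<Otimes>\<^sub>M ?B) (\<lambda>\<omega>. (?X \<omega>, ?Y \<omega>))"
    by (simp add: indep_var_distribution_eq)
  have fresh: "distr (distr M ?B ?Y) N (\<lambda>s. s k) = N"
    by (subst distr_distr) (auto simp: comp_def distr)
  have "distr M (S \<Otimes>\<^sub>M N) (\<lambda>\<omega>. (\<phi> (?X \<omega>), \<xi> k \<omega>))
      = distr (distr M (?A \<Otimes>\<^sub>M ?B) (\<lambda>\<omega>. (?X \<omega>, ?Y \<omega>))) (S \<Otimes>\<^sub>M N) (\<lambda>(p, s). (\<phi> p, s k))"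
    by (subst distr_distr) (auto simp: comp_def)
  also have "\<dots> = distr (distr M ?A ?X) S \<phi> \<Otimes>\<^sub>M distr (distr M ?B ?Y) N (\<lambda>s. s k)"
    unfolding joint[symmetric]
  proof (rule pair_measure_distr[symmetric])
    show "sigma_finite_measure (distr (distr M ?B ?Y) N (\<lambda>s. s k))"
      unfolding fresh using prob_space_distr[of "\<xi> k" N]
      by (simp add: distr prob_space_imp_sigma_finite)
  qed auto
  also have "distr (distr M ?A ?X) S \<phi> = distr M S (\<lambda>\<omega>. \<phi> (?X \<omega>))"
    by (subst distr_distr) (auto simp: comp_def)
  finally show ?thesis
    unfolding fresh .
qed

text \<open>
  This is the conditioning step of the analysis: a bound on the mean over one seed that holds for
  every deterministic \<open>v\<close> may be used with \<open>v\<close> replaced by a quantity computed from earlier seeds.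
  With nonnegative integrals no integrability has to be known in advance; it comes out at the end
  from finiteness of the bound.
\<close>

lemma nn_integral_fresh_seed_le:
  fixes \<xi> :: "nat \<Rightarrow> 'w \<Rightarrow> 's"
  assumes M: "prob_space M" and indep: "prob_space.indep_vars M (\<lambda>_. N) \<xi> UNIV"
    and distr: "distr M N (\<xi> k) = N"
    and \<phi>[measurable]: "\<phi> \<in> measurable (PiM {..<k} (\<lambda>_. N)) S"
    and h[measurable]: "h \<in> borel_measurable (S \<Otimes>\<^sub>M N)"
    and H[measurable]: "H \<in> borel_measurable S"
    and le: "\<And>v. v \<in> space S \<Longrightarrow> (\<integral>\<^sup>+s. h (v, s) \<partial>N) \<le> H v"
  shows "(\<integral>\<^sup>+\<omega>. h (\<phi> (restrict (\<lambda>i. \<xi> i \<omega>) {..<k}), \<xi> k \<omega>) \<partial>M)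
    \<le> (\<integral>\<^sup>+\<omega>. H (\<phi> (restrict (\<lambda>i. \<xi> i \<omega>) {..<k})) \<partial>M)"
proof -
  interpret M: prob_space M by fact
  have [measurable]: "\<xi> i \<in> measurable M N" for i
    using indep by (simp add: M.indep_vars_def)
  interpret N: prob_space N
    using M.prob_space_distr[of "\<xi> k" N] by (simp add: distr)
  let ?X = "\<lambda>\<omega>. \<phi> (restrict (\<lambda>i. \<xi> i \<omega>) {..<k})"
  have "(\<lambda>\<omega>. restrict (\<lambda>i. \<xi> i \<omega>) {..<k}) \<in> measurable M (PiM {..<k} (\<lambda>_. N))"
    by (auto intro!: measurable_restrict)
  then have [measurable]: "?X \<in> measurable M S"
    by measurable
  have "(\<integral>\<^sup>+\<omega>. h (?X \<omega>, \<xi> k \<omega>) \<partial>M) = (\<integral>\<^sup>+z. h z \<partial>distr M (S \<Otimes>\<^sub>M N) (\<lambda>\<omega>. (?X \<omega>, \<xi> k \<omega>)))"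
    by (subst nn_integral_distr) auto
  also have "\<dots> = (\<integral>\<^sup>+z. h z \<partial>(distr M S ?X \<Otimes>\<^sub>M N))"
    by (simp only: distr_past_and_fresh_seed[OF M indep distr \<phi>])
  also have "\<dots> = (\<integral>\<^sup>+v. (\<integral>\<^sup>+s. h (v, s) \<partial>N) \<partial>distr M S ?X)"
    by (subst N.nn_integral_fst[symmetric]) (auto cong: measurable_cong_sets)
  also have "\<dots> \<le> (\<integral>\<^sup>+v. H v \<partial>distr M S ?X)"
    by (intro nn_integral_mono le) auto
  also have "\<dots> = (\<integral>\<^sup>+\<omega>. H (?X \<omega>) \<partial>M)"
    by (subst nn_integral_distr) auto
  finally show ?thesis .
qed

lemma integrable_and_integral_le_if_nn_integral_le:
  fixes h :: "'a \<Rightarrow> real"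
  assumes "h \<in> borel_measurable M" and nn: "\<And>\<omega>. \<omega> \<in> space M \<Longrightarrow> 0 \<le> h \<omega>"
    and le: "(\<integral>\<^sup>+\<omega>. ennreal (h \<omega>) \<partial>M) \<le> ennreal C" and "0 \<le> C"
  shows "integrable M h \<and> integral\<^sup>L M h \<le> C"
proof
  show int: "integrable M h"
    using assms by (intro integrableI_nonneg) (auto intro: le_less_trans)
  have "ennreal (integral\<^sup>L M h) \<le> ennreal C"
    using le nn_integral_eq_integral[OF int] nn by simp
  then show "integral\<^sup>L M h \<le> C"
    using \<open>0 \<le> C\<close> by simp
qed

text \<open>
  The trajectory is written as a function of the whole seed sequence, so that its dependence on the
  first \<open>k\<close> seeds alone can be stated on plain sequences, without reference to a probability space.
\<close>

fun iterate :: "('v \<Rightarrow> 's \<Rightarrow> 'v) \<Rightarrow> 'v \<Rightarrow> nat \<Rightarrow> (nat \<Rightarrow> 's) \<Rightarrow> 'v" where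
  "iterate T v 0 s = v"
| "iterate T v (Suc k) s = T (iterate T v k s) (s k)"

lemma iterate_cong:
  assumes "\<And>i. i < k \<Longrightarrow> s i = s' i"
  shows "iterate T v k s = iterate T v k s'"
  using assms by (induction k) auto

lemma iterate_restrict: "iterate T v k (restrict s {..<k}) = iterate T v k s"
  by (rule iterate_cong) simp

lemma measurable_iterate:
  fixes T :: "'v \<Rightarrow> 's \<Rightarrow> 'v"
  assumes T: "case_prod T \<in> measurable (S \<Otimes>\<^sub>M N) S" and "v \<in> space S" and "k \<le> n"
  shows "iterate T v k \<in> measurable (PiM {..<n} (\<lambda>_. N)) S"
  using \<open>k \<le> n\<close>
proof (induction k)
  case 0
  then show ?case using assms by simp
next
  case (Suc k)
  then have [measurable]: "iterate T v k \<in> measurable (PiM {..<n} (\<lambda>_. N)) S"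
    and k: "k \<in> {..<n}" by auto
  have [measurable]: "(\<lambda>s. s k) \<in> measurable (PiM {..<n} (\<lambda>_. N)) N"
    using k by (rule measurable_component_singleton)
  have "(\<lambda>s. case_prod T (iterate T v k s, s k)) \<in> measurable (PiM {..<n} (\<lambda>_. N)) S"
    by (rule measurable_compose[OF _ T]) measurable
  then show ?case by simp
qed

text \<open>
  A random map that contracts the mean squared distance to \<open>z\<close> by the factor \<open>r\<close> from every
  deterministic starting point does so along the trajectory driven by independent seeds.
\<close>

lemma second_moment_iterate_le:
  fixes T :: "'v::euclidean_space \<Rightarrow> 's \<Rightarrow> 'v"
  assumes M: "prob_space M" and indep: "prob_space.indep_vars M (\<lambda>_. N) \<xi> UNIV"
    and distr: "\<And>k. distr M N (\<xi> k) = N"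
    and T: "case_prod T \<in> borel_measurable (borel \<Otimes>\<^sub>M N)"
    and "0 \<le> r"
    and contr: "\<And>v. (\<integral>\<^sup>+s. ennreal ((norm (T v s - z))\<^sup>2) \<partial>N) \<le> ennreal (r * (norm (v - z))\<^sup>2)"
  shows "integrable M (\<lambda>\<omega>. (norm (iterate T v k (\<lambda>i. \<xi> i \<omega>) - z))\<^sup>2)"
    and "(\<integral>\<omega>. (norm (iterate T v k (\<lambda>i. \<xi> i \<omega>) - z))\<^sup>2 \<partial>M) \<le> r ^ k * (norm (v - z))\<^sup>2"
proof -
  interpret M: prob_space M by fact
  let ?X = "\<lambda>k \<omega>. iterate T v k (\<lambda>i. \<xi> i \<omega>)"
  have \<xi>[measurable]: "\<xi> i \<in> measurable M N" for i
    using indep by (simp add: M.indep_vars_def)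
  have iter: "iterate T v k \<in> borel_measurable (PiM {..<k} (\<lambda>_. N))" for k
    using T by (rule measurable_iterate) auto
  have "(\<lambda>\<omega>. restrict (\<lambda>i. \<xi> i \<omega>) {..<k}) \<in> measurable M (PiM {..<k} (\<lambda>_. N))" for k
    by (auto intro!: measurable_restrict)
  from measurable_compose[OF this iter]
  have X[measurable]: "?X k \<in> borel_measurable M" for k
    by (simp add: iterate_restrict)
  have bound: "(\<integral>\<^sup>+\<omega>. ennreal ((norm (?X k \<omega> - z))\<^sup>2) \<partial>M) \<le> ennreal (r ^ k * (norm (v - z))\<^sup>2)" for k
  proof (induction k)
    case 0
    then show ?case by (simp add: M.emeasure_space_1)
  next
    case (Suc k)
    have dist_meas: "(\<lambda>p. (norm (case_prod T p - z))\<^sup>2) \<in> borel_measurable (borel \<Otimes>\<^sub>M N)"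
      by (rule measurable_compose[OF T]) measurable
    have "(\<integral>\<^sup>+\<omega>. ennreal ((norm (?X (Suc k) \<omega> - z))\<^sup>2) \<partial>M)
        = (\<integral>\<^sup>+\<omega>. ennreal ((norm (case_prod T (?X k \<omega>, \<xi> k \<omega>) - z))\<^sup>2) \<partial>M)"
      by simp
    also have "\<dots> \<le> (\<integral>\<^sup>+\<omega>. ennreal (r * (norm (?X k \<omega> - z))\<^sup>2) \<partial>M)"
      using contr dist_meas
      by (intro nn_integral_fresh_seed_le[OF M indep distr iter,
            where h = "\<lambda>p. ennreal ((norm (case_prod T p - z))\<^sup>2)"
              and H = "\<lambda>w. ennreal (r * (norm (w - z))\<^sup>2)", unfolded iterate_restrict]) auto
    also have "\<dots> = ennreal r * (\<integral>\<^sup>+\<omega>. ennreal ((norm (?X k \<omega> - z))\<^sup>2) \<partial>M)"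
      using \<open>0 \<le> r\<close> by (simp add: ennreal_mult nn_integral_cmult)
    also have "\<dots> \<le> ennreal r * ennreal (r ^ k * (norm (v - z))\<^sup>2)"
      by (intro mult_left_mono Suc.IH) simp
    also have "\<dots> = ennreal (r ^ Suc k * (norm (v - z))\<^sup>2)"
      using \<open>0 \<le> r\<close> by (simp add: ennreal_mult[symmetric] mult.assoc)
    finally show ?case .
  qed
  have "integrable M (\<lambda>\<omega>. (norm (?X k \<omega> - z))\<^sup>2) \<and>
      (\<integral>\<omega>. (norm (?X k \<omega> - z))\<^sup>2 \<partial>M) \<le> r ^ k * (norm (v - z))\<^sup>2"
    using bound \<open>0 \<le> r\<close> by (intro integrable_and_integral_le_if_nn_integral_le) auto
  then show "integrable M (\<lambda>\<omega>. (norm (?X k \<omega> - z))\<^sup>2)"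
    and "(\<integral>\<omega>. (norm (?X k \<omega> - z))\<^sup>2 \<partial>M) \<le> r ^ k * (norm (v - z))\<^sup>2"
    by auto
qed

section \<open>Quantized vectors\<close>

lemma quantized_step_second_moment:
  fixes Q :: "'s \<Rightarrow> real ^ 'd \<Rightarrow> real ^ 'd"
  assumes Q: "unbiased_quantizer N Q \<alpha>"
  shows "integrable N (\<lambda>s. (norm (u - \<gamma> *\<^sub>R Q s v))\<^sup>2)"
    and "(\<integral>s. (norm (u - \<gamma> *\<^sub>R Q s v))\<^sup>2 \<partial>N)
           \<le> (norm u)\<^sup>2 - 2 * \<gamma> * (v \<bullet> u) + \<gamma>\<^sup>2 * \<alpha> * (norm v)\<^sup>2"
proof -
  interpret prob_space N using Q by (simp add: unbiased_quantizer_def)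
  have int: "integrable N (\<lambda>s. Q s v)" and mean: "(\<integral>s. Q s v \<partial>N) = v"
    and int2: "integrable N (\<lambda>s. (norm (Q s v))\<^sup>2)"
    and var: "(\<integral>s. (norm (Q s v))\<^sup>2 \<partial>N) \<le> \<alpha> * (norm v)\<^sup>2"
    using Q by (auto simp: unbiased_quantizer_def)
  have expand: "(norm (u - \<gamma> *\<^sub>R Q s v))\<^sup>2
      = (norm u)\<^sup>2 - 2 * \<gamma> * (Q s v \<bullet> u) + \<gamma>\<^sup>2 * (norm (Q s v))\<^sup>2" for s
    unfolding power2_norm_eq_inner
    by (simp add: inner_diff_left inner_diff_right inner_commute power2_eq_square algebra_simps)
  show "integrable N (\<lambda>s. (norm (u - \<gamma> *\<^sub>R Q s v))\<^sup>2)"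
    unfolding expand using int int2 by simp
  have "(\<integral>s. (norm (u - \<gamma> *\<^sub>R Q s v))\<^sup>2 \<partial>N)
      = (norm u)\<^sup>2 - 2 * \<gamma> * (v \<bullet> u) + \<gamma>\<^sup>2 * (\<integral>s. (norm (Q s v))\<^sup>2 \<partial>N)"
    unfolding expand using int int2 by (simp add: mean prob_space)
  also have "\<dots> \<le> (norm u)\<^sup>2 - 2 * \<gamma> * (v \<bullet> u) + \<gamma>\<^sup>2 * (\<alpha> * (norm v)\<^sup>2)"
    using var by (intro add_left_mono mult_left_mono) auto
  finally show "(\<integral>s. (norm (u - \<gamma> *\<^sub>R Q s v))\<^sup>2 \<partial>N)
           \<le> (norm u)\<^sup>2 - 2 * \<gamma> * (v \<bullet> u) + \<gamma>\<^sup>2 * \<alpha> * (norm v)\<^sup>2"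
    by (simp add: mult.assoc)
qed

text \<open>
  Here \<open>v\<close> is the gradient and \<open>u\<close> the displacement from the minimizer. Since
  \<open>\<gamma> * \<alpha> = 2 / (\<mu> + K)\<close>, the term in the squared norm of \<open>v\<close> that quantization adds equals the one
  that \<open>grad\<close> takes away.
\<close>

lemma quantized_step_contraction:
  fixes Q :: "'s \<Rightarrow> real ^ 'd \<Rightarrow> real ^ 'd"
  assumes Q: "unbiased_quantizer N Q \<alpha>"
    and grad: "(norm v)\<^sup>2 + \<mu> * K * (norm u)\<^sup>2 \<le> (\<mu> + K) * (v \<bullet> u)"
    and "0 < \<mu>" "0 < K"
    and \<gamma>: "\<gamma> = 1 / \<alpha> * (2 / (\<mu> + K))"
  shows "(\<integral>s. (norm (u - \<gamma> *\<^sub>R Q s v))\<^sup>2 \<partial>N)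
           \<le> exp (- (4 * \<mu> * K / (\<alpha> * (\<mu> + K)\<^sup>2))) * (norm u)\<^sup>2"
proof -
  have "0 < \<alpha>" using Q by (simp add: unbiased_quantizer_def)
  then have "0 < \<gamma>" using assms by simp
  have \<gamma>\<alpha>: "\<gamma> * \<alpha> = 2 / (\<mu> + K)"
    using \<open>0 < \<alpha>\<close> by (simp add: \<gamma>)
  have "\<gamma>\<^sup>2 * \<alpha> * (norm v)\<^sup>2 = 2 * \<gamma> * ((norm v)\<^sup>2 / (\<mu> + K))"
    using \<gamma>\<alpha> by (simp add: power2_eq_square mult.assoc)
  moreover have "(norm v)\<^sup>2 / (\<mu> + K) + \<mu> * K / (\<mu> + K) * (norm u)\<^sup>2 \<le> v \<bullet> u"
    using divide_right_mono[OF grad, of "\<mu> + K"] assms by (simp add: add_divide_distrib)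
  then have "2 * \<gamma> * ((norm v)\<^sup>2 / (\<mu> + K) + \<mu> * K / (\<mu> + K) * (norm u)\<^sup>2) \<le> 2 * \<gamma> * (v \<bullet> u)"
    using \<open>0 < \<gamma>\<close> by (intro mult_left_mono) auto
  ultimately have "(norm u)\<^sup>2 - 2 * \<gamma> * (v \<bullet> u) + \<gamma>\<^sup>2 * \<alpha> * (norm v)\<^sup>2
      \<le> (norm u)\<^sup>2 - 2 * \<gamma> * (\<mu> * K / (\<mu> + K)) * (norm u)\<^sup>2"
    by (simp add: algebra_simps)
  also have "2 * \<gamma> * (\<mu> * K / (\<mu> + K)) = 4 * \<mu> * K / (\<alpha> * (\<mu> + K)\<^sup>2)"
    by (simp add: \<gamma> power2_eq_square mult.assoc)
  also have "(norm u)\<^sup>2 - 4 * \<mu> * K / (\<alpha> * (\<mu> + K)\<^sup>2) * (norm u)\<^sup>2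
      = (1 + - (4 * \<mu> * K / (\<alpha> * (\<mu> + K)\<^sup>2))) * (norm u)\<^sup>2"
    by (simp add: algebra_simps)
  \<comment> \<open>A factor that is to be iterated must be nonnegative. The exponential is so by its form,
    whereas for the linear factor this would take an argument that \<open>\<alpha> \<ge> 1\<close>.\<close>
  also have "\<dots> \<le> exp (- (4 * \<mu> * K / (\<alpha> * (\<mu> + K)\<^sup>2))) * (norm u)\<^sup>2"
    by (intro mult_right_mono exp_ge_add_one_self) auto
  finally show ?thesis
    using quantized_step_second_moment(2)[OF Q, of u \<gamma> v] by linarith
qed

lemma borel_measurable_nnz [measurable]: "(\<lambda>v :: real ^ 'd :: finite. real (nnz v)) \<in> borel_measurable borel"
proof -
  have "real (nnz v) = (\<Sum>i\<in>UNIV. of_bool (v $ i \<noteq> 0))" for v :: "real ^ 'd"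
    by (simp add: nnz_def supp_def)
  then have eq: "real (nnz v) = (\<Sum>i\<in>UNIV. indicator {z. z $ i \<noteq> 0} v)" for v :: "real ^ 'd"
    by (simp add: indicator_def)
  have "{z::real ^ 'd. z $ i \<noteq> 0} \<in> sets borel" for i :: 'd
    by (intro borel_open open_Collect_neq continuous_intros)
  then show ?thesis
    unfolding eq by (intro borel_measurable_sum borel_measurable_indicator)
qed

lemma nnz_le_card: "nnz (v :: real ^ 'd) \<le> CARD('d)"
  unfolding nnz_def by (intro card_mono) auto

text \<open>
  The number of nonzero entries is at most the dimension, so for each fixed vector it is integrable
  and the assumption on its Bochner integral is also one on the nonnegative integral.
\<close>

lemma expected_nnz_quantized_le:
  fixes Q :: "'s \<Rightarrow> real ^ 'd \<Rightarrow> real ^ 'd" and \<xi> :: "nat \<Rightarrow> 'w \<Rightarrow> 's"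
  assumes M: "prob_space M" and indep: "prob_space.indep_vars M (\<lambda>_. N) \<xi> UNIV"
    and distr: "distr M N (\<xi> k) = N"
    and \<phi>: "\<phi> \<in> borel_measurable (PiM {..<k} (\<lambda>_. N))"
    and Q: "case_prod Q \<in> borel_measurable (N \<Otimes>\<^sub>M borel)"
    and sparse: "\<And>v. (\<integral>s. real (nnz (Q s v)) \<partial>N) \<le> c"
  shows "integrable M (\<lambda>\<omega>. real (nnz (Q (\<xi> k \<omega>) (\<phi> (restrict (\<lambda>i. \<xi> i \<omega>) {..<k})))))"
    and "(\<integral>\<omega>. real (nnz (Q (\<xi> k \<omega>) (\<phi> (restrict (\<lambda>i. \<xi> i \<omega>) {..<k})))) \<partial>M) \<le> c"
proof -
  interpret M: prob_space M by fact
  have [measurable]: "\<xi> i \<in> measurable M N" for i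
    using indep by (simp add: M.indep_vars_def)
  interpret N: prob_space N
    using M.prob_space_distr[of "\<xi> k" N] by (simp add: distr)
  let ?X = "\<lambda>\<omega>. \<phi> (restrict (\<lambda>i. \<xi> i \<omega>) {..<k})"
  have "(\<lambda>\<omega>. restrict (\<lambda>i. \<xi> i \<omega>) {..<k}) \<in> measurable M (PiM {..<k} (\<lambda>_. N))"
    by (auto intro!: measurable_restrict)
  from measurable_compose[OF this \<phi>]
  have X[measurable]: "?X \<in> borel_measurable M" .
  have [measurable]: "(\<lambda>p. Q (snd p) (fst p)) \<in> borel_measurable (borel \<Otimes>\<^sub>M N)"
    using measurable_compose[OF measurable_pair_swap' Q] by (simp add: case_prod_unfold)
  have inner: "(\<integral>\<^sup>+s. ennreal (real (nnz (Q s v))) \<partial>N) \<le> ennreal c" for v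
  proof -
    have [measurable]: "(\<lambda>s. Q s v) \<in> borel_measurable N"
      using measurable_compose[OF measurable_Pair2' Q] by simp
    have "integrable N (\<lambda>s. real (nnz (Q s v)))"
      by (rule N.integrable_const_bound[where B = "real CARD('d)"]) (auto simp: nnz_le_card)
    then have "(\<integral>\<^sup>+s. ennreal (real (nnz (Q s v))) \<partial>N) = ennreal (\<integral>s. real (nnz (Q s v)) \<partial>N)"
      by (rule nn_integral_eq_integral) simp
    then show ?thesis using sparse by (simp add: ennreal_leI)
  qed
  have "0 \<le> c"
    using sparse[of 0] by (rule order_trans[rotated]) simp
  have "(\<integral>\<^sup>+\<omega>. ennreal (real (nnz (Q (\<xi> k \<omega>) (?X \<omega>)))) \<partial>M) \<le> (\<integral>\<^sup>+\<omega>. ennreal c \<partial>M)"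
    using inner
    by (intro nn_integral_fresh_seed_le[OF M indep distr \<phi>,
          where h = "\<lambda>p. ennreal (real (nnz (Q (snd p) (fst p))))" and H = "\<lambda>_. ennreal c",
          unfolded fst_conv snd_conv]) auto
  also have "\<dots> = ennreal c"
    by (simp add: M.emeasure_space_1)
  finally have le: "(\<integral>\<^sup>+\<omega>. ennreal (real (nnz (Q (\<xi> k \<omega>) (?X \<omega>)))) \<partial>M) \<le> ennreal c" .
  have "(\<lambda>\<omega>. (\<xi> k \<omega>, ?X \<omega>)) \<in> measurable M (N \<Otimes>\<^sub>M borel)"
    by measurable
  from measurable_compose[OF this Q]
  have [measurable]: "(\<lambda>\<omega>. Q (\<xi> k \<omega>) (?X \<omega>)) \<in> borel_measurable M"
    by simp
  have "integrable M (\<lambda>\<omega>. real (nnz (Q (\<xi> k \<omega>) (?X \<omega>)))) \<and>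
      (\<integral>\<omega>. real (nnz (Q (\<xi> k \<omega>) (?X \<omega>))) \<partial>M) \<le> c"
    using le \<open>0 \<le> c\<close> by (intro integrable_and_integral_le_if_nn_integral_le) auto
  then show "integrable M (\<lambda>\<omega>. real (nnz (Q (\<xi> k \<omega>) (?X \<omega>))))"
    and "(\<integral>\<omega>. real (nnz (Q (\<xi> k \<omega>) (?X \<omega>))) \<partial>M) \<le> c"
    by auto
qed

text \<open>
  At \<open>\<epsilon>0 = 0\<close> the convention \<open>ln 0 = 0\<close> admits every \<open>k\<close>, rightly so, as there is nothing left to
  decay; for \<open>\<epsilon>0 < \<epsilon>\<close> the logarithm is negative and again every \<open>k\<close> is admitted.
\<close>

lemma geometric_decay_le:
  fixes q :: real
  assumes "0 < q" "0 < \<epsilon>" "0 \<le> \<epsilon>0" and k: "1 / q * ln (\<epsilon>0 / \<epsilon>) \<le> real k"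
  shows "exp (- q) ^ k * \<epsilon>0 \<le> \<epsilon>"
proof (cases "\<epsilon>0 = 0")
  case True
  then show ?thesis using assms by simp
next
  case False
  have "ln (\<epsilon>0 / \<epsilon>) \<le> real k * q"
    using k \<open>0 < q\<close> by (simp add: field_simps)
  then have "\<epsilon>0 / \<epsilon> \<le> exp (real k * q)"
    using assms False by (metis divide_pos_pos exp_le_cancel_iff exp_ln order_le_less)
  then show ?thesis
    using assms by (simp add: exp_of_nat_mult[symmetric] exp_minus field_simps)
qed

theorem corollary4p2:
  fixes m :: nat
    and f :: "real ^ 'd \<Rightarrow> real"
    and F :: "nat \<Rightarrow> real ^ 'd \<Rightarrow> real"
    and l :: "real \<Rightarrow> real \<Rightarrow> real"
    and a :: "nat \<Rightarrow> real ^ 'd"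
    and b :: "nat \<Rightarrow> real"
    and L \<mu> \<Delta> Lbar \<alpha> c B \<epsilon> \<epsilon>0 k_star B_star :: real
    and N :: "'s measure"
    and Q :: "'s \<Rightarrow> real ^ 'd \<Rightarrow> real ^ 'd"
    and M :: "'w measure"
    and \<xi> :: "nat \<Rightarrow> 'w \<Rightarrow> 's"
    and x :: "nat \<Rightarrow> 'w \<Rightarrow> real ^ 'd"
    and x0 x_star :: "real ^ 'd"
    and \<gamma> :: "nat \<Rightarrow> real"
  assumes f_sum: "\<And>z. f z = (\<Sum>i=1..m. F i z)"
    and smooth: "\<And>i. i \<in> {1..m} \<Longrightarrow> convex_smooth L (F i)"
    and data: "\<And>i z. i \<in> {1..m} \<Longrightarrow> F i z = l (a i \<bullet> z) (b i)"
    and data_supp: "\<And>i z. i \<in> {1..m} \<Longrightarrow> supp (gradient (F i) z) = supp (a i)"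
    and mu_pos: "0 < \<mu>"
    and strong: "strongly_convex \<mu> f"
    and minimizer: "\<And>z. f x_star \<le> f z"
    and Delta: "\<Delta> = min (Delta_ave m a) (Delta_max m a)"
    and Lbar: "Lbar = L * sqrt (real m * (1 + \<Delta>))"
    and quantizer: "unbiased_quantizer N Q \<alpha>"
    and c_bounds: "0 < c" "c \<le> real CARD('d)"
    and c_sparse: "\<And>v. (\<integral>s. real (nnz (Q s v)) \<partial>N) \<le> c"
    and B_nonneg: "0 \<le> B"
    and prob: "prob_space M"
    and fresh_indep: "prob_space.indep_vars M (\<lambda>_. N) \<xi> UNIV"
    and fresh_distr: "\<And>k. distr M N (\<xi> k) = N"
    and step_size: "\<And>k. \<gamma> k = 1 / \<alpha> * (2 / (\<mu> + Lbar))"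
    and init: "\<And>\<omega>. \<omega> \<in> space M \<Longrightarrow> x 0 \<omega> = x0"
    and step: "\<And>k \<omega>. \<omega> \<in> space M \<Longrightarrow>
          x (Suc k) \<omega> = x k \<omega> - \<gamma> k *\<^sub>R Q (\<xi> k \<omega>) (gradient f (x k \<omega>))"
    and eps_pos: "0 < \<epsilon>"
    and eps0: "\<epsilon>0 = (norm (x0 - x_star))\<^sup>2"
    and k_star: "k_star = \<alpha> * ((\<mu> + Lbar)\<^sup>2 / (4 * \<mu> * Lbar)) * ln (\<epsilon>0 / \<epsilon>)"
    and B_star: "B_star = (log 2 (real CARD('d)) + B) * c *
          (\<alpha> * ((\<mu> + Lbar)\<^sup>2 / (4 * \<mu> * Lbar)) * ln (\<epsilon>0 / \<epsilon>))"
  shows "(\<forall>k. k_star \<le> real k \<longrightarrow>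
            integrable M (\<lambda>\<omega>. (norm (x k \<omega> - x_star))\<^sup>2) \<and>
            (\<integral>\<omega>. (norm (x k \<omega> - x_star))\<^sup>2 \<partial>M) \<le> \<epsilon>) \<and>
         naive_bits CARD('d) c B k_star = B_star \<and>
         (\<forall>k. integrable M (\<lambda>\<omega>. \<Sum>t<k. encoding_bits B (Q (\<xi> t \<omega>) (gradient f (x t \<omega>)))) \<and>
            (\<integral>\<omega>. (\<Sum>t<k. encoding_bits B (Q (\<xi> t \<omega>) (gradient f (x t \<omega>)))) \<partial>M)
              \<le> naive_bits CARD('d) c B (real k))"
proof -
  define g where "g = gradient f"
  let ?G = "\<lambda>z. \<Sum>i=1..m. gradient (F i) z"
  have f: "f = (\<lambda>z. \<Sum>i=1..m. F i z)"
    using f_sum by auto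
  have g_deriv: "GDERIV f z :> ?G z" for z
    unfolding f using smooth by (intro GDERIV_sum GDERIV_gradient) (auto simp: convex_smooth_def)
  then have g_eq: "g z = ?G z" for z
    unfolding g_def by (rule gradient_eqI)
  have lower: "f u + g u \<bullet> (v - u) + \<mu> / 2 * (norm (v - u))\<^sup>2 \<le> f v" for u v
    using strong by (simp add: strongly_convex_def g_def)

  \<comment> \<open>Strong convexity rules out \<open>m = 0\<close> and \<open>L \<le> 0\<close>, since its constant cannot exceed that of
    the crude quadratic upper bound, \<open>m * L\<close>.\<close>
  have "f v \<le> f u + g u \<bullet> (v - u) + real m * L / 2 * (norm (v - u))\<^sup>2" for u v
  proof -
    have "f v \<le> (\<Sum>i=1..m. F i u + gradient (F i) u \<bullet> (v - u) + L / 2 * (norm (v - u))\<^sup>2)"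
      unfolding f using smooth by (intro sum_mono) (auto simp: convex_smooth_def)
    then show ?thesis
      by (simp add: g_eq f sum.distrib inner_sum_left)
  qed
  then have "\<mu> \<le> real m * L"
    by (rule quadratic_bounds_le[OF lower])
  then have "0 < real m * L"
    using mu_pos by linarith
  then have "0 < m" and "0 < L"
    by (auto simp: zero_less_mult_iff)

  have "\<Delta> = Delta_ave m a"
    using Delta Delta_ave_le_Delta_max[OF \<open>0 < m\<close>, of a] by simp
  then have lip: "norm (g u - g v) \<le> Lbar * norm (u - v)" for u v
    unfolding g_eq Lbar
    using lipschitz_gradient_sum[OF smooth _ \<open>0 < m\<close> \<open>0 < L\<close>, where a = a and x = u and y = v] data_supp by simp
  have upper: "f v \<le> f u + g u \<bullet> (v - u) + Lbar / 2 * (norm (v - u))\<^sup>2" for u v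
    using g_deriv lip unfolding g_eq[symmetric] by (rule quadratic_upper_bound_of_lipschitz_gradient)
  have "\<mu> \<le> Lbar"
    using lower upper by (rule quadratic_bounds_le)
  then have "0 < Lbar"
    using mu_pos by linarith

  have "GDERIV f x_star :> g x_star"
    using g_deriv by (simp add: g_eq)
  then have "(\<lambda>h. h \<bullet> g x_star) = (\<lambda>h. 0)"
    unfolding gderiv_def
    by (rule differential_zero_maxmin[of x_star UNIV, rotated 2]) (use minimizer in auto)
  then have g_star: "g x_star = 0"
    by (metis inner_eq_zero_iff)
  have grad: "(norm (g v))\<^sup>2 + \<mu> * Lbar * (norm (v - x_star))\<^sup>2 \<le> (\<mu> + Lbar) * (g v \<bullet> (v - x_star))" for v
    using strongly_convex_gradient_inequality[OF lower upper \<open>\<mu> \<le> Lbar\<close>, of v x_star]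
    by (simp add: g_star)

  \<comment> \<open>The method is the iteration of the random map \<open>T\<close>, where \<open>1 / q\<close> is the factor in front of the
    logarithm in \<open>k_star\<close>.\<close>
  define \<gamma>0 where "\<gamma>0 = 1 / \<alpha> * (2 / (\<mu> + Lbar))"
  define T where "T v s = v - \<gamma>0 *\<^sub>R Q s (g v)" for v s
  define q where "q = 4 * \<mu> * Lbar / (\<alpha> * (\<mu> + Lbar)\<^sup>2)"
  have Q: "case_prod Q \<in> borel_measurable (N \<Otimes>\<^sub>M borel)" and "0 < \<alpha>"
    using quantizer by (auto simp: unbiased_quantizer_def)
  have "0 < q"
    using mu_pos \<open>0 < Lbar\<close> \<open>0 < \<alpha>\<close> by (simp add: q_def)
  have x_eq: "x k \<omega> = iterate T x0 k (\<lambda>i. \<xi> i \<omega>)" if "\<omega> \<in> space M" for k \<omega>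
    using that by (induction k) (auto simp: init step step_size T_def \<gamma>0_def g_def)

  have "Lbar-lipschitz_on UNIV g"
    using lip \<open>0 < Lbar\<close> by (intro lipschitz_onI) (auto simp: dist_norm)
  then have g_meas[measurable]: "g \<in> borel_measurable borel"
    by (intro borel_measurable_continuous_onI lipschitz_on_continuous_on)
  have "(\<lambda>p. (snd p, g (fst p))) \<in> measurable (borel \<Otimes>\<^sub>M N) (N \<Otimes>\<^sub>M borel)"
    by measurable
  from measurable_compose[OF this Q]
  have [measurable]: "(\<lambda>p. Q (snd p) (g (fst p))) \<in> borel_measurable (borel \<Otimes>\<^sub>M N)"
    by simp
  have T: "case_prod T \<in> borel_measurable (borel \<Otimes>\<^sub>M N)"
    unfolding T_def case_prod_unfold by measurable

  have contr: "(\<integral>\<^sup>+s. ennreal ((norm (T v s - x_star))\<^sup>2) \<partial>N) \<le> ennreal (exp (- q) * (norm (v - x_star))\<^sup>2)" for v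
  proof -
    have T_eq: "T v s - x_star = (v - x_star) - \<gamma>0 *\<^sub>R Q s (g v)" for s
      by (simp add: T_def)
    show ?thesis
      unfolding T_eq q_def
      using quantized_step_contraction[OF quantizer grad mu_pos \<open>0 < Lbar\<close> \<gamma>0_def, of v]
      by (subst nn_integral_eq_integral[OF quantized_step_second_moment(1)[OF quantizer]])
         (auto intro: ennreal_leI)
  qed

  have "integrable M (\<lambda>\<omega>. (norm (x k \<omega> - x_star))\<^sup>2) \<and>
      (\<integral>\<omega>. (norm (x k \<omega> - x_star))\<^sup>2 \<partial>M) \<le> \<epsilon>" if k: "k_star \<le> real k" for k
  proof -
    have "exp (- q) ^ k * \<epsilon>0 \<le> \<epsilon>"
    proof (rule geometric_decay_le)
      have "1 / q = \<alpha> * ((\<mu> + Lbar)\<^sup>2 / (4 * \<mu> * Lbar))"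
        by (simp add: q_def)
      then show "1 / q * ln (\<epsilon>0 / \<epsilon>) \<le> real k"
        using k by (simp only: k_star)
    qed (use \<open>0 < q\<close> eps_pos eps0 in auto)
    with second_moment_iterate_le[OF prob fresh_indep fresh_distr T _ contr, of x0 k]
    show ?thesis
      by (auto simp: eps0 x_eq cong: Bochner_Integration.integrable_cong Bochner_Integration.integral_cong)
  qed
  moreover have "naive_bits CARD('d) c B k_star = B_star"
    by (simp add: naive_bits_def k_star B_star)
  moreover have "integrable M (\<lambda>\<omega>. \<Sum>t<k. encoding_bits B (Q (\<xi> t \<omega>) (gradient f (x t \<omega>)))) \<and>
      (\<integral>\<omega>. (\<Sum>t<k. encoding_bits B (Q (\<xi> t \<omega>) (gradient f (x t \<omega>)))) \<partial>M)
        \<le> naive_bits CARD('d) c B (real k)" for k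
  proof -
    let ?X = "\<lambda>t \<omega>. g (iterate T x0 t (\<lambda>i. \<xi> i \<omega>))"
    define w where "w = log 2 (real CARD('d)) + B"
    have "0 \<le> w"
      using B_nonneg by (auto simp: w_def Suc_le_eq intro!: add_nonneg_nonneg)
    have "(\<lambda>s. g (iterate T x0 t s)) \<in> borel_measurable (PiM {..<t} (\<lambda>_. N))" for t
      by (rule measurable_compose[OF measurable_iterate[OF T] g_meas]) auto
    note nnz = expected_nnz_quantized_le[OF prob fresh_indep fresh_distr this Q c_sparse,
        unfolded iterate_restrict]
    have int: "integrable M (\<lambda>\<omega>. \<Sum>t<k. real (nnz (Q (\<xi> t \<omega>) (?X t \<omega>))) * w)"
      using nnz(1) by simp
    have "(\<integral>\<omega>. (\<Sum>t<k. real (nnz (Q (\<xi> t \<omega>) (?X t \<omega>))) * w) \<partial>M)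
        = (\<Sum>t<k. (\<integral>\<omega>. real (nnz (Q (\<xi> t \<omega>) (?X t \<omega>))) \<partial>M) * w)"
      using nnz(1) by simp
    also have "\<dots> \<le> (\<Sum>t<k. c * w)"
      using nnz(2) \<open>0 \<le> w\<close> by (intro sum_mono mult_right_mono)
    also have "\<dots> = naive_bits CARD('d) c B (real k)"
      by (simp add: naive_bits_def w_def)
    finally show ?thesis
      using int
      by (simp add: encoding_bits_def w_def x_eq g_def
          cong: Bochner_Integration.integrable_cong Bochner_Integration.integral_cong)
  qed
  ultimately show ?thesis by blast
qed

end
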